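(* Let $G$ be a countable discrete group and let $(X,T,G)$ be a topological dynamical system. Assume that there exists $N\in\mathbb{N}$ such that for every $\varepsilon>0$ there exist points $x_i,y_i\in X$ for $i\in\{1,\dots,N\}$ and sets $\Omega_i^{(\varepsilon)}\subseteq G$, $i\in\{1,\dots,N\}$, such that \begin{itemize} \item for each $i$, the points $x_i$ and $y_i$ are distinct, and $d(T^gx_i,T^gy_i)\le\varepsilon$ for all $g\in\Omega_i^{(\varepsilon)}$; \item the collection $\Omega_1^{(\varepsilon)},\dots,\Omega_N^{(\varepsilon)}$ is thickly full. \end{itemize} Then $(X,T,G)$ does not have $2N$-fold strong topological minimal self-joinings.
   Context: A topological dynamical system $(X,T,G)$ is a compact metric space $(X,d)$ with a continuous action $T$ of $G$, written $T^g\colon X\to X$, with $T^{1_G}=\mathrm{id}_X$ and $T^{g}\circ T^{g'}=T^{gg'}$. $Z(G)$ denotes the center of $G$. For $n\ge 1$, $(X,T,G)$ has $n$-fold strong topological minimal self-joinings ($n$-fold sTMSJ) if $X$ is infinite and for every $1\le k\le n$ and every $k$ distinct points $x_1,\dots,x_k\in X$ all lying in different $Z(G)$-orbits, the orbit $\{(T^gx_1,\dots,T^gx_k): g\in G\}$ is dense in $X^k$. In particular such a system is minimal. A subset $G'\subseteq G$ is thick if it contains arbitrarily large balls for a proper right-invariant metric on $G$; equivalently, for every finite $F\subseteq G$ there is $g\in G$ with $Fg\subseteq G'$. A collection $\Omega_1,\dots,\Omega_N$ of subsets of $G$ is thickly full if each $\Omega_i$ is thick and $G\setminus\bigcup_i\Omega_i$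 is finite. *)

theory Defs
  imports "HOL-Analysis.Analysis" "HOL-Algebra.Group_Action"
begin

text \<open>Topological dynamical systems. The space is a compact subset \<open>X\<close> of a type of class
  \<open>metric_space\<close>. As always for \<open>group_action\<close>, each map \<open>T g\<close> is extensional on \<open>X\<close>, i.e. has
  the value \<open>undefined\<close> outside of \<open>X\<close>.\<close>

locale topological_dynamical_system = group_action G X T
  for G :: "('g, 'm) monoid_scheme" (structure)
    and X :: "'a::metric_space set"
    and T :: "'g \<Rightarrow> 'a \<Rightarrow> 'a" +
  assumes compact_space: "compact X"
    and continuous_action: "\<And>g. g \<in> carrier G \<Longrightarrow> continuous_on X (T g)"

definition group_center :: "('g, 'm) monoid_scheme \<Rightarrow> 'g set"
  where "group_center G =
    {z \<in> carrier G. \<forall>g \<in> carrier G. z \<otimes>\<^bsub>G\<^esub> g = g \<otimes>\<^bsub>G\<^esub> z}"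

definition center_orbit :: "('g, 'm) monoid_scheme \<Rightarrow> ('g \<Rightarrow> 'a \<Rightarrow> 'a) \<Rightarrow> 'a \<Rightarrow> 'a set"
  where "center_orbit G T x = orbit (G\<lparr>carrier := group_center G\<rparr>) T x"

text \<open>The power \<open>X\<^sup>k\<close> consists of the functions in \<open>{1..k} \<rightarrow>\<^sub>E X\<close>, with the product topology.\<close>

definition power_topology :: "'a::metric_space set \<Rightarrow> nat \<Rightarrow> (nat \<Rightarrow> 'a) topology"
  where "power_topology X k = product_topology (\<lambda>_. top_of_set X) {1..k}"

definition diagonal_orbit ::
    "('g, 'm) monoid_scheme \<Rightarrow> ('g \<Rightarrow> 'a \<Rightarrow> 'a) \<Rightarrow> nat \<Rightarrow> (nat \<Rightarrow> 'a) \<Rightarrow> (nat \<Rightarrow> 'a) set"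
  where "diagonal_orbit G T k x = {(\<lambda>i \<in> {1..k}. T g (x i)) | g. g \<in> carrier G}"

text \<open>Strong topological minimal self-joinings; the notion is meant for \<open>n \<ge> 1\<close>.\<close>

definition n_fold_sTMSJ ::
    "nat \<Rightarrow> ('g, 'm) monoid_scheme \<Rightarrow> 'a::metric_space set \<Rightarrow> ('g \<Rightarrow> 'a \<Rightarrow> 'a) \<Rightarrow> bool"
  where "n_fold_sTMSJ n G X T \<longleftrightarrow>
    infinite X \<and>
    (\<forall>k \<in> {1..n}. \<forall>x \<in> {1..k} \<rightarrow>\<^sub>E X.
      inj_on x {1..k} \<and>
      (\<forall>i \<in> {1..k}. \<forall>j \<in> {1..k}. i \<noteq> j \<longrightarrow> center_orbit G T (x i) \<noteq> center_orbit G T (x j))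
      \<longrightarrow> power_topology X k closure_of diagonal_orbit G T k x = topspace (power_topology X k))"

text \<open>The coset notation \<open>F #> g\<close> denotes the translate \<open>F g\<close>. See \<open>thick_iff_balls\<close> below for
  the description in terms of large balls.\<close>

definition thick :: "('g, 'm) monoid_scheme \<Rightarrow> 'g set \<Rightarrow> bool"
  where "thick G A \<longleftrightarrow> A \<subseteq> carrier G \<and>
    (\<forall>F. finite F \<and> F \<subseteq> carrier G \<longrightarrow> (\<exists>g \<in> carrier G. F #>\<^bsub>G\<^esub> g \<subseteq> A))"

definition thickly_full :: "('g, 'm) monoid_scheme \<Rightarrow> nat \<Rightarrow> (nat \<Rightarrow> 'g set) \<Rightarrow> bool"
  where "thickly_full G N \<Omega> \<longleftrightarrow>
    (\<forall>i \<in> {1..N}. thick G (\<Omega> i)) \<and> finite (carrier G - (\<Union>i \<in> {1..N}. \<Omega> i))"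

text \<open>For the discrete topology a metric is proper iff its balls are finite.\<close>

lemma thick_iff_balls:
  fixes G (structure) and \<rho> :: "'g \<Rightarrow> 'g \<Rightarrow> real"
  assumes "group G" and metric: "Metric_space (carrier G) \<rho>"
    and right_invariant: "\<And>a b c. \<lbrakk>a \<in> carrier G; b \<in> carrier G; c \<in> carrier G\<rbrakk>
      \<Longrightarrow> \<rho> (a \<otimes> c) (b \<otimes> c) = \<rho> a b"
    and proper: "\<And>a r. a \<in> carrier G \<Longrightarrow> finite (Metric_space.mball (carrier G) \<rho> a r)"
  shows "thick G A \<longleftrightarrow> A \<subseteq> carrier G \<and>
    (\<forall>r. \<exists>g \<in> carrier G. Metric_space.mball (carrier G) \<rho> g r \<subseteq> A)"
proof -
  interpret group G by fact
  interpret Metric_space "carrier G" \<rho> by fact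
  have ball: "mball \<one> r #> g = mball g r" if g: "g \<in> carrier G" for g r
  proof (intro equalityI subsetI)
    fix y assume "y \<in> mball \<one> r #> g"
    then obtain h where h: "h \<in> carrier G" "\<rho> \<one> h < r" "y = h \<otimes> g"
      by (auto simp: r_coset_def)
    then show "y \<in> mball g r"
      using right_invariant[of \<one> h g] g by simp
  next
    fix y assume y: "y \<in> mball g r"
    then have c: "y \<in> carrier G" "y \<otimes> inv g \<in> carrier G" "(y \<otimes> inv g) \<otimes> g = y"
      using g by (auto simp: m_assoc)
    then have "y \<otimes> inv g \<in> mball \<one> r"
      using right_invariant[of \<one> "y \<otimes> inv g" g] g y by simp
    then show "y \<in> mball \<one> r #> g"
      using c(3) by (force simp: r_coset_def)
  qed
  have sub: "\<exists>r. F \<subseteq> mball \<one> r" if F: "finite F" "F \<subseteq> carrier G" for F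
  proof -
    obtain r where "\<forall>h\<in>F. \<rho> \<one> h \<le> r"
      using F(1) by (metis finite_imageI bdd_above_finite bdd_above.E imageI)
    then show ?thesis using F(2) by (intro exI[of _ "r + 1"]) force
  qed
  show ?thesis
  proof (intro iffI conjI allI)
    assume "thick G A"
    then show "A \<subseteq> carrier G" by (simp add: thick_def)
    fix r
    have "finite (mball \<one> r)" "mball \<one> r \<subseteq> carrier G" using proper by auto
    with \<open>thick G A\<close> show "\<exists>g \<in> carrier G. mball g r \<subseteq> A"
      using ball unfolding thick_def by metis
  next
    assume *: "A \<subseteq> carrier G \<and> (\<forall>r. \<exists>g \<in> carrier G. mball g r \<subseteq> A)"
    have "\<exists>g \<in> carrier G. F #> g \<subseteq> A" if F: "finite F" "F \<subseteq> carrier G" for F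
    proof -
      obtain r where r: "F \<subseteq> mball \<one> r" using sub F by blast
      obtain g where g: "g \<in> carrier G" "mball g r \<subseteq> A" using * by blast
      then have "F #> g \<subseteq> mball g r"
        using r ball[of g r] by (auto simp: r_coset_def)
      with g show ?thesis by blast
    qed
    with * show "thick G A" by (simp add: thick_def)
  qed
qed

end

theory Submission
  imports Defs
begin

text \<open>Suppose that the system has \<open>2N\<close>-fold sTMSJ. Two points in different center orbits separate by
  a fixed distance along some \<open>g\<close>, so every point whose joint orbit with \<open>x\<close> stays within a small
  \<open>d\<close> is \<open>T z x\<close> for a central \<open>z\<close> that moves all points by at most \<open>d\<close>. These points form a
  countable compact set; if central elements could act nontrivially but arbitrarily close to the
  identity, a suitable \<open>d\<close> would make it perfect, which is impossible. Since two points in one center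
  orbit that stay \<open>\<epsilon>\<close>-close along a thick set yield a central element moving every point by at most
  \<open>\<epsilon>\<close>, for small \<open>\<epsilon>\<close> the points \<open>x\<^sub>i\<close> and \<open>y\<^sub>i\<close> lie in different center orbits.

  Let \<open>u\<^sub>1, \<dots>, u\<^sub>k\<close> represent the center orbits of all \<open>x\<^sub>i, y\<^sub>i\<close>; their joint orbit is dense in
  \<open>X\<^sup>k\<close>. There are \<open>N + 1\<close> points that remain \<open>2\<epsilon>\<close>-separated under all central elements, so each of
  the \<open>N\<close> closeness conditions excludes at most one of them when a coordinate is chosen. Hence a
  nonempty open subset of \<open>X\<^sup>k\<close> violates all \<open>N\<close> conditions, and as \<open>X\<close> is perfect it is visited by
  some \<open>g\<close> outside any prescribed finite set, contradicting thick fullness.\<close>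

section \<open>Minimal systems: the center, near returns, perfectness\<close>

locale minimal_system = topological_dynamical_system +
  assumes infinite_space: "infinite X"
    and minimal: "\<lbrakk>x \<in> X; openin (top_of_set X) U; U \<noteq> {}\<rbrakk> \<Longrightarrow> \<exists>g \<in> carrier G. T g x \<in> U"
begin

sublocale group G
  using group_hom group_hom.axioms(1) by blast

abbreviation Z where "Z \<equiv> group_center G"

lemma center_carrier: "z \<in> Z \<Longrightarrow> z \<in> carrier G"
  by (simp add: group_center_def)

lemma one_center: "\<one> \<in> Z"
  by (simp add: group_center_def)

lemma mult_center: "\<lbrakk>z \<in> Z; w \<in> Z\<rbrakk> \<Longrightarrow> z \<otimes> w \<in> Z"
  unfolding group_center_def by (smt (verit) m_assoc m_closed mem_Collect_eq)

lemma inv_center: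
  assumes "z \<in> Z" shows "inv z \<in> Z"
proof -
  have "inv z \<otimes> g = g \<otimes> inv z" if g: "g \<in> carrier G" for g
  proof -
    have "inv (z \<otimes> inv g) = inv (inv g \<otimes> z)" using assms g by (simp add: group_center_def)
    with center_carrier[OF assms] g show ?thesis by (simp add: inv_mult_group)
  qed
  with assms show ?thesis by (simp add: group_center_def)
qed

lemma in_space: "\<lbrakk>g \<in> carrier G; x \<in> X\<rbrakk> \<Longrightarrow> T g x \<in> X"
  using element_image by blast

lemma act_one: "x \<in> X \<Longrightarrow> T \<one> x = x"
  using id_eq_one by (metis restrict_apply')

lemma act_inv: "\<lbrakk>g \<in> carrier G; x \<in> X\<rbrakk> \<Longrightarrow> T (inv g) (T g x) = x"
  using orbit_sym_aux by blast

lemma center_commute: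
  assumes "z \<in> Z" "g \<in> carrier G" "x \<in> X"
  shows "T z (T g x) = T g (T z x)"
proof -
  have "T z (T g x) = T (z \<otimes> g) x"
    using assms composition_rule center_carrier by metis
  also have "z \<otimes> g = g \<otimes> z" using assms by (simp add: group_center_def)
  finally show ?thesis using assms composition_rule center_carrier by metis
qed

lemma in_center_orbit: "y \<in> center_orbit G T x \<longleftrightarrow> (\<exists>z \<in> Z. y = T z x)"
  by (auto simp: center_orbit_def orbit_def)

lemma center_orbit_eq_iff:
  assumes "x \<in> X" "y \<in> X"
  shows "center_orbit G T x = center_orbit G T y \<longleftrightarrow> (\<exists>z \<in> Z. x = T z y)"
proof
  assume "center_orbit G T x = center_orbit G T y"
  moreover have "x \<in> center_orbit G T x"
    using assms act_one one_center by (metis in_center_orbit)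
  ultimately show "\<exists>z \<in> Z. x = T z y" by (simp add: in_center_orbit)
next
  have sub: "center_orbit G T (T z y) \<subseteq> center_orbit G T y" if "z \<in> Z" "y \<in> X" for z y
    using that by (auto simp: in_center_orbit)
      (metis center_carrier composition_rule mult_center)
  assume "\<exists>z \<in> Z. x = T z y"
  then obtain z where z: "z \<in> Z" "x = T z y" by blast
  then have "y = T (inv z) x" using act_inv center_carrier assms by metis
  then show "center_orbit G T x = center_orbit G T y"
    using sub[of z y] sub[of "inv z" x] z inv_center assms by auto
qed

lemma continuous_dist_act:
  assumes "s \<in> carrier G" "t \<in> carrier G"
  shows "continuous_on X (\<lambda>x. dist (T s x) (T t x))"
  using assms continuous_action by (intro continuous_intros)

lemma openin_dist_act:
  assumes "s \<in> carrier G" "t \<in> carrier G"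
  shows "openin (top_of_set X) {x \<in> X. dist (T s x) (T t x) > (e::real)}"
proof -
  have "{x \<in> X. dist (T s x) (T t x) > e} = X \<inter> (\<lambda>x. dist (T s x) (T t x)) -` {e<..}" by auto
  then show ?thesis
    using continuous_openin_preimage_gen[OF continuous_dist_act[OF assms], of "{e<..}"] by simp
qed

text \<open>A violation at \<open>p\<close> is an open condition on the point, so by minimality the
  orbit of \<open>x\<close> would meet it too.\<close>

lemma dist_le_everywhere:
  assumes "s \<in> carrier G" "t \<in> carrier G" "x \<in> X" "p \<in> X"
    and "\<And>g. g \<in> carrier G \<Longrightarrow> dist (T s (T g x)) (T t (T g x)) \<le> (e::real)"
  shows "dist (T s p) (T t p) \<le> e"
proof (rule ccontr)
  assume "\<not> ?thesis"
  then have "{x \<in> X. dist (T s x) (T t x) > e} \<noteq> {}" using assms(4) by auto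
  from minimal[OF assms(3) openin_dist_act[OF assms(1,2)] this] assms(5)
  show False by force
qed

text \<open>Central elements commute with the action, so agreement at \<open>x\<close> spreads along
  its orbit and then, with bound 0, to all of \<open>X\<close>. Thus \<open>T z\<close> is
  determined by a single value.\<close>

lemma center_agree:
  assumes "s \<in> Z" "t \<in> Z" "x \<in> X" "T s x = T t x" "p \<in> X"
  shows "T s p = T t p"
proof -
  have "dist (T s p) (T t p) \<le> 0"
    by (rule dist_le_everywhere[where x=x])
      (use assms in \<open>auto simp: center_carrier center_commute\<close>)
  then show ?thesis by simp
qed

text \<open>If \<open>z\<close> moved \<open>p\<close> by more than \<open>e\<close>, it would do so
  on an open set \<open>U\<close>. By minimality and compactness, finitely many \<open>f\<close>
  suffice to bring every point into \<open>U\<close>. Thickness puts a translate of this finite set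
  inside \<open>A\<close>, so some element of \<open>A\<close> takes \<open>x\<close> into
  \<open>U\<close>.\<close>

lemma thick_near_return:
  assumes "thick G A" "z \<in> Z" "x \<in> X" "p \<in> X"
    and le: "\<And>g. g \<in> A \<Longrightarrow> dist (T g (T z x)) (T g x) \<le> (e::real)"
  shows "dist (T z p) p \<le> e"
proof (rule ccontr)
  assume neg: "\<not> ?thesis"
  define U where "U = {x \<in> X. dist (T z x) (T \<one> x) > e}"
  have U: "openin (top_of_set X) U" "U \<noteq> {}"
    unfolding U_def using neg assms center_carrier act_one by (auto intro!: openin_dist_act)
  have op: "openin (top_of_set X) (X \<inter> T f -` U)" if "f \<in> carrier G" for f
    using continuous_openin_preimage[OF continuous_action[OF that] _ U(1)] that in_space by auto
  then have "\<forall>f. \<exists>W. f \<in> carrier G \<longrightarrow> open W \<and> X \<inter> T f -` U = X \<inter> W"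
    by (metis openin_open)
  then obtain W where W: "\<And>f. f \<in> carrier G \<Longrightarrow> open (W f)"
    "\<And>f. f \<in> carrier G \<Longrightarrow> X \<inter> T f -` U = X \<inter> W f" by metis
  have cov: "X \<subseteq> (\<Union>f\<in>carrier G. W f)"
  proof
    fix q assume q: "q \<in> X"
    then obtain f where "f \<in> carrier G" "T f q \<in> U" using minimal U by blast
    with q W(2)[of f] show "q \<in> (\<Union>f\<in>carrier G. W f)" by blast
  qed
  obtain F where F: "F \<subseteq> carrier G" "finite F" "X \<subseteq> (\<Union>f\<in>F. W f)"
    using compactE_image[OF compact_space W(1) cov] by metis
  then obtain g where g: "g \<in> carrier G" "F #> g \<subseteq> A" using assms(1) by (auto simp: thick_def)
  have gx: "T g x \<in> X" using g assms in_space by blast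
  then obtain f where f: "f \<in> F" "T g x \<in> W f" using F by blast
  then have fc: "f \<in> carrier G" using F by blast
  then have "T f (T g x) \<in> U" using W(2)[of f] f gx by blast
  then have fg: "T (f \<otimes> g) x \<in> U" using composition_rule fc g assms by metis
  have "f \<otimes> g \<in> A" using g f by (auto simp: r_coset_def)
  from le[OF this] have "dist (T z (T (f \<otimes> g) x)) (T (f \<otimes> g) x) \<le> e"
    using center_commute[OF assms(2)] fc g assms by simp
  with fg show False using act_one by (auto simp: U_def)
qed

text \<open>An isolated point \<open>x\<close> would be hit by the orbit of an accumulation point
  \<open>y\<close>. By continuity, some \<open>T g\<close> would then send \<open>y\<close> and a
  nearby second point to \<open>x\<close>, against injectivity.\<close>

lemma islimpt_space:
  assumes "x \<in> X" shows "x islimpt X"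
proof (rule ccontr)
  assume "\<not> x islimpt X"
  then obtain V where V: "open V" "x \<in> V" "X \<inter> V \<subseteq> {x}"
    unfolding islimpt_def by blast
  obtain y where y: "y \<in> X" "y islimpt X"
    using Heine_Borel_imp_Bolzano_Weierstrass[OF compact_space infinite_space] by blast
  have "openin (top_of_set X) (X \<inter> V)" using V by blast
  then obtain g where g: "g \<in> carrier G" "T g y \<in> X \<inter> V"
    using minimal[OF y(1)] V assms by blast
  have "openin (top_of_set X) (X \<inter> T g -` (X \<inter> V))"
    using continuous_openin_preimage[OF continuous_action[OF g(1)] _ \<open>openin _ (X \<inter> V)\<close>]
      g in_space by auto
  then obtain W where W: "open W" "X \<inter> T g -` (X \<inter> V) = X \<inter> W" by (metis openin_open)
  then have "y \<in> W" using y g by blast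
  then obtain q where q: "q \<in> X" "q \<in> W" "q \<noteq> y" using y(2) W(1) unfolding islimpt_def by blast
  then have "T g q = x" "T g y = x" using W(2) V(3) g y by blast+
  then show False using inj_prop[OF g(1)] q y by (metis inj_onD)
qed

section \<open>Separation under the center and discreteness of the center\<close>

text \<open>Supplies the points from which coordinates are chosen later. An infinite center orbit is
  itself such a set; if some center orbit is finite, the center acts through finitely many maps and
  all of \<open>X\<close> works.\<close>

lemma infinite_center_separated:
  obtains S where "S \<subseteq> X" "infinite S"
    "\<And>p q. \<lbrakk>p \<in> S; q \<in> S; p \<noteq> q\<rbrakk> \<Longrightarrow> \<exists>e>0. \<forall>z \<in> Z. dist (T z p) (T z q) \<ge> (e::real)"
proof -
  obtain x where x: "x \<in> X" using infinite_space by (metis finite.emptyI ex_in_conv)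
  show ?thesis
  proof (cases "finite (center_orbit G T x)")
    case False
    \<comment> \<open>Central elements commute, so \<open>T z\<close> only moves the base point \<open>y\<close> in \<open>dist (T s y) (T t y)\<close>,
      which is bounded below by compactness.\<close>
    show ?thesis
    proof (rule that[OF _ False])
      show "center_orbit G T x \<subseteq> X" using x in_space center_carrier by (auto simp: in_center_orbit)
      fix p q assume "p \<in> center_orbit G T x" "q \<in> center_orbit G T x" and ne: "p \<noteq> q"
      then obtain s t where st: "s \<in> Z" "t \<in> Z" "p = T s x" "q = T t x"
        by (auto simp: in_center_orbit)
      obtain y where y: "y \<in> X" "\<And>v. v \<in> X \<Longrightarrow> dist (T s y) (T t y) \<le> dist (T s v) (T t v)"
        using continuous_attains_inf[OF compact_space _ continuous_dist_act[of s t]] st x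
          center_carrier by blast
      have "T s y \<noteq> T t y" using center_agree[of s t y x] st ne x y by auto
      moreover have "dist (T z p) (T z q) \<ge> dist (T s y) (T t y)" if "z \<in> Z" for z
        using y(2)[of "T z x"] that st x in_space center_carrier center_commute by metis
      ultimately show "\<exists>e>0. \<forall>z \<in> Z. dist (T z p) (T z q) \<ge> e"
        by (intro exI[of _ "dist (T s y) (T t y)"]) auto
    qed
  next
    case True
    show ?thesis
    proof (rule that[OF order_refl infinite_space])
      fix p q assume pq: "p \<in> X" "q \<in> X" "p \<noteq> q"
      define D where "D = (\<lambda>z. dist (T z p) (T z q)) ` Z"
      \<comment> \<open>By \<open>center_agree\<close>, \<open>T z x\<close> determines
        \<open>T z\<close> on \<open>X\<close>. So \<open>f\<close> reads the distance off that
        point, and \<open>D\<close> inherits finiteness from the center orbit.\<close>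
      define f where "f v = (let z = SOME z. z \<in> Z \<and> v = T z x in dist (T z p) (T z q))" for v
      have "D \<subseteq> f ` center_orbit G T x"
      proof
        fix d assume "d \<in> D"
        then obtain z where z: "z \<in> Z" "d = dist (T z p) (T z q)" by (auto simp: D_def)
        define w where "w = (SOME w. w \<in> Z \<and> T z x = T w x)"
        have w: "w \<in> Z \<and> T z x = T w x"
          unfolding w_def by (rule someI[of _ z]) (use z in auto)
        have "f (T z x) = dist (T w p) (T w q)"
          by (simp add: f_def Let_def w_def)
        also have "\<dots> = d" using z center_agree[of z w x] w x pq by simp
        finally have "f (T z x) = d" .
        moreover have "T z x \<in> center_orbit G T x" using z by (auto simp: in_center_orbit)
        ultimately show "d \<in> f ` center_orbit G T x" by blast
      qed
      then have fin: "finite D" using True finite_surj by blast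
      have "D \<noteq> {}" using one_center by (auto simp: D_def)
      then have "Min D \<in> D" using fin by simp
      moreover have "\<exists>z \<in> Z. v = dist (T z p) (T z q)" if "v \<in> D" for v
        using that by (auto simp: D_def)
      ultimately obtain z where z: "z \<in> Z" "Min D = dist (T z p) (T z q)" by blast
      then have "Min D > 0"
        using pq inj_prop[of z] center_carrier by (auto simp: inj_on_def)
      then show "\<exists>e>0. \<forall>z \<in> Z. dist (T z p) (T z q) \<ge> e"
        using fin by (intro exI[of _ "Min D"]) (auto simp: D_def)
    qed
  qed
qed

lemma infinite_openin:
  assumes "openin (top_of_set X) U" "U \<noteq> {}"
  shows "infinite U"
proof -
  obtain V where V: "open V" "U = X \<inter> V" using assms(1) by (auto simp: openin_open)
  with assms(2) obtain x e where x: "x \<in> X" "(e::real) > 0" "ball x e \<subseteq> V"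
    by (metis IntE ex_in_conv open_contains_ball)
  then have "infinite (X \<inter> ball x e)"
    using islimpt_space islimpt_eq_infinite_ball by blast
  moreover have "X \<inter> ball x e \<subseteq> U" using x V by blast
  ultimately show ?thesis using finite_subset by blast
qed

text \<open>The action may have a kernel, so discreteness concerns the maps \<open>T z\<close>, not
  the elements \<open>z\<close>. The separation \<open>sep\<close> will come from density of joint
  orbits of pairs.\<close>

lemma center_uniformly_discrete:
  fixes r :: real
  assumes cnt: "countable (carrier G)" and "r > 0"
    and sep: "\<And>x y. \<lbrakk>x \<in> X; y \<in> X; center_orbit G T x \<noteq> center_orbit G T y\<rbrakk>
      \<Longrightarrow> \<exists>g \<in> carrier G. dist (T g x) (T g y) > r"
  shows "\<exists>e>0. \<forall>z \<in> Z. (\<forall>p \<in> X. dist (T z p) p \<le> e) \<longrightarrow> (\<forall>p \<in> X. T z p = p)"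
proof (rule ccontr)
  assume "\<not> ?thesis"
  then have small: "\<exists>z \<in> Z. (\<forall>p \<in> X. dist (T z p) p \<le> e) \<and> (\<exists>p \<in> X. T z p \<noteq> p)" if "e > 0" for e
    using that by blast
  obtain x where x: "x \<in> X" using infinite_space by (metis finite.emptyI ex_in_conv)
  define m where "m z = (SUP p\<in>X. dist (T z p) p)" for z
  \<comment> \<open>Avoiding the countably many values of \<open>m\<close> makes \<open>m z \<le> d\<close> an open condition on \<open>z\<close>, hence
    the set \<open>C\<close> below is perfect.\<close>
  have cZ: "countable Z" using cnt by (rule countable_subset[rotated]) (auto simp: center_carrier)
  then have "countable (m ` Z)" by simp
  moreover have "uncountable {0<..<r}" using \<open>r > 0\<close> by (simp add: uncountable_open_interval)
  ultimately obtain d where d: "0 < d" "d < r" "d \<notin> m ` Z"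
    by (metis countable_subset greaterThanLessThan_iff subsetI)
  define C where "C = {y \<in> X. \<forall>g \<in> carrier G. dist (T g x) (T g y) \<le> d}"
  have "closedin (top_of_set X) {y \<in> X. dist (T g x) (T g y) \<le> d}" if "g \<in> carrier G" for g
  proof -
    have "{y \<in> X. dist (T g x) (T g y) \<le> d} = X \<inter> (\<lambda>y. dist (T g x) (T g y)) -` {..d}" by auto
    moreover have "continuous_on X (\<lambda>y. dist (T g x) (T g y))"
      using continuous_action[OF that] by (intro continuous_intros)
    ultimately show ?thesis using continuous_closedin_preimage by fastforce
  qed
  then have "closedin (top_of_set X) (\<Inter>g\<in>carrier G. {y \<in> X. dist (T g x) (T g y) \<le> d})"
    by (intro closedin_INT) auto
  also have "(\<Inter>g\<in>carrier G. {y \<in> X. dist (T g x) (T g y) \<le> d}) = C"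
    unfolding C_def by blast
  finally have comp: "compact C" using closedin_compact compact_space by blast
  have xC: "x \<in> C" using x d by (simp add: C_def)
  \<comment> \<open>As \<open>d < r\<close>, \<open>sep\<close> puts \<open>y\<close> in the center
    orbit of \<open>x\<close>. The bound \<open>d\<close> for \<open>z\<close> spreads from the
    orbit of \<open>x\<close> to \<open>X\<close>, and it is strict for \<open>m z\<close> because
    \<open>d\<close> is not a value of \<open>m\<close>.\<close>
  have C_rep: "\<exists>z \<in> Z. y = T z x \<and> m z < d \<and> (\<forall>p \<in> X. dist (T z p) p \<le> m z)" if y: "y \<in> C" for y
  proof -
    have yX: "y \<in> X" and le: "\<And>g. g \<in> carrier G \<Longrightarrow> dist (T g x) (T g y) \<le> d"
      using y by (auto simp: C_def)
    have "center_orbit G T y = center_orbit G T x"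
      using sep[OF x yX] le d by (metis leD less_le_trans order_less_imp_le)
    then obtain z where z: "z \<in> Z" "y = T z x"
      using center_orbit_eq_iff x yX by blast
    have "dist (T z p) (T \<one> p) \<le> d" if p: "p \<in> X" for p
    proof (rule dist_le_everywhere[where x=x])
      fix g assume g: "g \<in> carrier G"
      then show "dist (T z (T g x)) (T \<one> (T g x)) \<le> d"
        using le[OF g] z x by (simp add: act_one in_space center_commute dist_commute)
    qed (use z x p center_carrier in auto)
    then have *: "dist (T z p) p \<le> d" if "p \<in> X" for p
      using that by (simp add: act_one)
    have "m z \<le> d" unfolding m_def using x * by (intro cSUP_least) auto
    moreover have "m z \<noteq> d" using d z by blast
    moreover have "dist (T z p) p \<le> m z" if "p \<in> X" for p
      unfolding m_def using that * by (intro cSUP_upper) (auto intro!: bdd_aboveI)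
    ultimately show ?thesis using z by auto
  qed
  then have "C \<subseteq> (\<lambda>z. T z x) ` Z" by blast
  then have countC: "countable C" by (rule countable_subset) (use cZ in simp)
  have lim: "\<exists>y' \<in> C. y' \<noteq> y \<and> dist y' y < e" if y: "y \<in> C" and e: "e > 0" for y e
  proof -
    have yX: "y \<in> X" using y by (simp add: C_def)
    obtain z where z: "z \<in> Z" "y = T z x" "m z < d" "\<And>p. p \<in> X \<Longrightarrow> dist (T z p) p \<le> m z"
      using C_rep[OF y] by blast
    \<comment> \<open>The slack \<open>d - m z\<close> keeps \<open>T w y\<close> in
      \<open>C\<close>; \<open>e / 2\<close> keeps it within \<open>e\<close> of
      \<open>y\<close>.\<close>
    define \<eta> where "\<eta> = min (e / 2) (d - m z)"
    have "\<eta> > 0" using e z by (simp add: \<eta>_def)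
    then obtain w p where w: "w \<in> Z" "\<And>p. p \<in> X \<Longrightarrow> dist (T w p) p \<le> \<eta>" "p \<in> X" "T w p \<noteq> p"
      using small by blast
    \<comment> \<open>A central element that moves some point fixes none.\<close>
    have "T w y \<noteq> y"
      using center_agree[of w \<one> y p] w yX by (auto simp: act_one one_center)
    moreover have "dist (T w y) y < e" using w(2)[OF yX] e by (simp add: \<eta>_def)
    moreover have "dist (T g x) (T g (T w y)) \<le> d" if g: "g \<in> carrier G" for g
    proof -
      have "T g (T w y) = T w (T g y)" using center_commute w g yX by simp
      moreover have "T g y = T z (T g x)" using center_commute z g x by simp
      moreover have "dist (T z (T g x)) (T g x) \<le> m z" using z g x in_space by blast
      moreover have "dist (T w (T g y)) (T g y) \<le> d - m z"
        using w(2)[of "T g y"] g yX in_space by (simp add: \<eta>_def)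
      ultimately show ?thesis
        using dist_triangle[of "T g x" "T g (T w y)" "T g y"] by (simp add: dist_commute)
    qed
    then have "T w y \<in> C" using yX w in_space center_carrier by (auto simp: C_def)
    ultimately show ?thesis by blast
  qed
  have "top_of_set C derived_set_of C = C"
  proof (intro equalityI subsetI)
    fix y assume y: "y \<in> C"
    have "\<exists>y'. y' \<noteq> y \<and> y' \<in> C \<and> y' \<in> V" if V: "y \<in> V" "openin (top_of_set C) V" for V
    proof -
      obtain e where "e > 0" "\<And>y'. \<lbrakk>y' \<in> C; dist y' y < e\<rbrakk> \<Longrightarrow> y' \<in> V"
        using V by (auto simp: openin_euclidean_subtopology_iff)
      then show ?thesis using lim[OF y] by metis
    qed
    then show "y \<in> top_of_set C derived_set_of C" using y by (simp add: in_derived_set_of)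
  qed (auto simp: in_derived_set_of)
  moreover have "locally_compact_space (top_of_set C)" "Hausdorff_space (top_of_set C)"
    using comp by (simp_all add: compact_imp_locally_compact_space compact_space_subtopology
        Hausdorff_space_subtopology)
  \<comment> \<open>A nonempty perfect set in a locally compact Hausdorff space has at least the
    cardinality of the reals, but \<open>C\<close> is countable.\<close>
  ultimately have "(UNIV :: real set) \<lesssim> C"
    using xC by (intro lepoll_perfect_set[of "top_of_set C"]) auto
  then have "countable (UNIV :: real set)" by (rule countable_lepoll[OF countC])
  then show False using uncountable_UNIV_real by simp
qed

end

section \<open>Greedy choice of coordinates\<close>

text \<open>The values are chosen in order of the index. With one side of a constraint fixed, at
  most one value on the other side is bad, so fewer than \<open>card P\<close> values are excluded
  at each index.\<close>

lemma exists_separating_choice: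
  fixes a b :: "'i \<Rightarrow> nat" and bad :: "'i \<Rightarrow> 'p \<Rightarrow> 'p \<Rightarrow> bool"
  assumes fin: "finite I" "finite P" and card: "card I < card P"
    and ne: "\<And>i. i \<in> I \<Longrightarrow> a i \<noteq> b i"
    and left: "\<And>i p p' q. \<lbrakk>i \<in> I; p \<in> P; p' \<in> P; bad i p q; bad i p' q\<rbrakk> \<Longrightarrow> p = p'"
    and right: "\<And>i p q q'. \<lbrakk>i \<in> I; q \<in> P; q' \<in> P; bad i p q; bad i p q'\<rbrakk> \<Longrightarrow> q = q'"
  shows "\<exists>c. range c \<subseteq> P \<and> (\<forall>i \<in> I. \<not> bad i (c (a i)) (c (b i)))"
proof -
  have "\<exists>c. range c \<subseteq> P \<and> (\<forall>i \<in> I. a i < k \<and> b i < k \<longrightarrow> \<not> bad i (c (a i)) (c (b i)))" for k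
  proof (induction k)
    case 0
    obtain p where "p \<in> P" using card by fastforce
    then show ?case by (intro exI[of _ "\<lambda>_. p"]) auto
  next
    case (Suc k)
    then obtain c where c: "range c \<subseteq> P"
      "\<And>i. \<lbrakk>i \<in> I; a i < k; b i < k\<rbrakk> \<Longrightarrow> \<not> bad i (c (a i)) (c (b i))" by blast
    \<comment> \<open>Constraints whose other index exceeds \<open>k\<close> are counted as well;
      each constraint still excludes at most one value.\<close>
    define B where "B i = {p \<in> P. a i = k \<and> bad i p (c (b i)) \<or> b i = k \<and> bad i (c (a i)) p}" for i
    have "card (B i) \<le> 1" if i: "i \<in> I" for i
    proof -
      have "p = p'" if "p \<in> B i" "p' \<in> B i" for p p'
        using that left[OF i, of p p'] right[OF i, of p p'] ne[OF i] by (auto simp: B_def)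
      moreover have "finite (B i)" using fin by (simp add: B_def)
      ultimately show ?thesis by (simp add: card_le_Suc0_iff_eq)
    qed
    then have "card (\<Union>i\<in>I. B i) \<le> (\<Sum>i\<in>I. 1)"
      using card_UN_le[OF fin(1), of B] sum_mono[of I "\<lambda>i. card (B i)" "\<lambda>_. 1"] by simp
    then have "card (\<Union>i\<in>I. B i) < card P" using card by simp
    moreover have "finite (\<Union>i\<in>I. B i)" using fin by (simp add: B_def)
    ultimately obtain p where p: "p \<in> P" "\<And>i. i \<in> I \<Longrightarrow> p \<notin> B i"
      by (metis UN_I card_mono leD subsetI)
    have "\<not> bad i ((c(k := p)) (a i)) ((c(k := p)) (b i))"
      if i: "i \<in> I" "a i < Suc k" "b i < Suc k" for i
      using p(1) p(2)[OF i(1)] c(2)[OF i(1)] i ne[OF i(1)] by (auto simp: B_def less_Suc_eq)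
    moreover have "range (c(k := p)) \<subseteq> P" using c p by auto
    ultimately show ?case by blast
  qed
  \<comment> \<open>The sum exceeds or equals every index that occurs, so this stage of the
    induction covers all constraints.\<close>
  then obtain c where c: "range c \<subseteq> P" "\<forall>i \<in> I. a i < Suc (\<Sum>i\<in>I. a i + b i) \<and>
      b i < Suc (\<Sum>i\<in>I. a i + b i) \<longrightarrow> \<not> bad i (c (a i)) (c (b i))" by blast
  have "a i + b i \<le> (\<Sum>i\<in>I. a i + b i)" if "i \<in> I" for i
    using that fin by (intro member_le_sum) auto
  with c show ?thesis by (intro exI[of _ c]) fastforce
qed

section \<open>Powers of \<open>X\<close> and first consequences of sTMSJ\<close>

lemma topspace_power: "topspace (power_topology X k) = {1..k} \<rightarrow>\<^sub>E X"
  by (simp add: power_topology_def)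

lemma continuous_map_power_projection:
  "i \<in> {1..k} \<Longrightarrow> continuous_map (power_topology X k) (top_of_set X) (\<lambda>c. c i)"
  unfolding power_topology_def by (rule continuous_map_product_projection)

lemma openin_power_dist:
  assumes "i \<in> {1..k}" "j \<in> {1..k}" "continuous_on X f" "continuous_on X h"
  shows "openin (power_topology X k)
    {c \<in> topspace (power_topology X k). dist (f (c i)) (h (c j)) > (e::real)}"
proof -
  have f: "continuous_map (power_topology X k) euclidean (\<lambda>c. f (c i))"
    if "i \<in> {1..k}" "continuous_on X f" for i and f :: "'a \<Rightarrow> 'b"
    using continuous_map_compose[OF continuous_map_power_projection[OF that(1)], of X euclidean f]
      that(2) by (simp add: o_def)
  have "continuous_map (power_topology X k) euclidean (\<lambda>c. (f (c i), h (c j)))"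
    using continuous_map_pairedI[OF f[OF assms(1,3)] f[OF assms(2,4)]] by simp
  moreover have "continuous_map euclidean euclideanreal (\<lambda>p. dist (fst p) (snd p :: 'b))"
    by (auto intro!: continuous_intros)
  ultimately have "continuous_map (power_topology X k) euclideanreal
      ((\<lambda>p. dist (fst p) (snd p)) \<circ> (\<lambda>c. (f (c i), h (c j))))"
    by (rule continuous_map_compose)
  then have "continuous_map (power_topology X k) euclideanreal (\<lambda>c. dist (f (c i)) (h (c j)))"
    by (simp add: o_def)
  from openin_continuous_map_preimage[OF this, of "{e<..}"] show ?thesis by simp
qed

text \<open>Density in the form used below: injectivity follows from the different center orbits,
  and \<open>u\<close> need not be extensional.\<close>

lemma sTMSJ_dense:
  assumes "n_fold_sTMSJ n G X T" "k \<in> {1..n}" "\<And>i. i \<in> {1..k} \<Longrightarrow> u i \<in> X"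
    and "\<And>i j. \<lbrakk>i \<in> {1..k}; j \<in> {1..k}; i \<noteq> j\<rbrakk>
      \<Longrightarrow> center_orbit G T (u i) \<noteq> center_orbit G T (u j)"
    and "openin (power_topology X k) V" "V \<noteq> {}"
  shows "\<exists>g \<in> carrier G. (\<lambda>i \<in> {1..k}. T g (u i)) \<in> V"
proof -
  define x where "x = restrict u {1..k}"
  have x: "x \<in> {1..k} \<rightarrow>\<^sub>E X" using assms(3) by (auto simp: x_def)
  have "inj_on x {1..k}" using assms(4) by (fastforce simp: x_def inj_on_def)
  moreover have "\<forall>i \<in> {1..k}. \<forall>j \<in> {1..k}. i \<noteq> j \<longrightarrow> center_orbit G T (x i) \<noteq> center_orbit G T (x j)"
    using assms(4) by (simp add: x_def)
  ultimately have "power_topology X k closure_of diagonal_orbit G T k x = topspace (power_topology X k)"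
    using assms(1,2) x unfolding n_fold_sTMSJ_def by blast
  moreover obtain v where v: "v \<in> V" using assms(6) by blast
  moreover have "v \<in> topspace (power_topology X k)" using v openin_subset[OF assms(5)] by blast
  ultimately have "v \<in> power_topology X k closure_of diagonal_orbit G T k x" by simp
  then obtain w where "w \<in> diagonal_orbit G T k x" "w \<in> V"
    unfolding in_closure_of using assms(5) v by blast
  moreover have "(\<lambda>i \<in> {1..k}. T g (x i)) = (\<lambda>i \<in> {1..k}. T g (u i))" for g
    by (auto simp: x_def)
  ultimately show ?thesis by (auto simp: diagonal_orbit_def)
qed

lemma sTMSJ_minimal_system:
  assumes "topological_dynamical_system G X T" "n_fold_sTMSJ n G X T" "n \<ge> 1"
  shows "minimal_system G X T"
proof -
  interpret topological_dynamical_system G X T by fact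
  show ?thesis
  proof
    show "infinite X" using assms by (simp add: n_fold_sTMSJ_def)
    fix x U assume x: "x \<in> X" and U: "openin (top_of_set X) U" "U \<noteq> {}"
    define V where "V = {c \<in> topspace (power_topology X 1). c 1 \<in> U}"
    have "openin (power_topology X 1) V"
      unfolding V_def using U(1)
      by (intro openin_continuous_map_preimage[OF continuous_map_power_projection]) auto
    moreover obtain p where "p \<in> U" using U by blast
    then have "(\<lambda>i \<in> {1..1::nat}. p) \<in> V"
      using openin_subset[OF U(1)] by (auto simp: V_def topspace_power)
    ultimately obtain g where "g \<in> carrier G" "(\<lambda>i \<in> {1..1::nat}. T g x) \<in> V"
      using sTMSJ_dense[OF assms(2), of 1 "\<lambda>_. x" V] x assms(3) by auto
    then show "\<exists>g \<in> carrier G. T g x \<in> U" by (auto simp: V_def)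
  qed
qed

text \<open>The joint orbit of \<open>x\<close> and \<open>y\<close> is dense in the square of
  \<open>X\<close>, so it comes near one fixed pair \<open>(a, b)\<close> of distinct points; half
  their distance serves for all \<open>x\<close> and \<open>y\<close>.\<close>

lemma sTMSJ_separated:
  assumes "topological_dynamical_system G X T" "n_fold_sTMSJ n G X T" "n \<ge> 2"
  obtains r where "r > 0" "\<And>x y. \<lbrakk>x \<in> X; y \<in> X; center_orbit G T x \<noteq> center_orbit G T y\<rbrakk>
    \<Longrightarrow> \<exists>g \<in> carrier G. dist (T g x) (T g y) > (r::real)"
proof -
  have "infinite X" using assms by (simp add: n_fold_sTMSJ_def)
  then obtain a where "a \<in> X" by (metis finite.emptyI ex_in_conv)
  moreover have "X - {a} \<noteq> {}" using infinite_remove[OF \<open>infinite X\<close>, of a] by (metis finite.emptyI)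
  ultimately obtain b where ab: "a \<in> X" "b \<in> X" "a \<noteq> b" by blast
  define r where "r = dist a b / 2"
  have r: "r > 0" "r < dist a b" using ab by (auto simp: r_def)
  show ?thesis
  proof (rule that[OF r(1)])
    fix x y assume xy: "x \<in> X" "y \<in> X" "center_orbit G T x \<noteq> center_orbit G T y"
    define V where "V = {c \<in> topspace (power_topology X 2). dist (c 1) (c 2) > r}"
    have "openin (power_topology X 2) V"
      unfolding V_def using openin_power_dist[of 1 2 2 X "\<lambda>x. x" "\<lambda>x. x"] by (simp add: continuous_on_id)
    moreover have "(\<lambda>i \<in> {1..2::nat}. if i = 1 then a else b) \<in> V"
      using ab r by (auto simp: V_def topspace_power)
    moreover have "center_orbit G T (if i = 1 then x else y) \<noteq> center_orbit G T (if j = 1 then x else y)"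
      if "i \<in> {1..2}" "j \<in> {1..2}" "i \<noteq> j" for i j :: nat
      using xy(3) that by (cases "i = 1"; cases "j = 1") auto
    ultimately have "\<exists>g \<in> carrier G. (\<lambda>i \<in> {1..2::nat}. T g (if i = 1 then x else y)) \<in> V"
      using xy assms(3) by (intro sTMSJ_dense[OF assms(2)]) auto
    then show "\<exists>g \<in> carrier G. dist (T g x) (T g y) > r" by (force simp: V_def)
  qed
qed

section \<open>The contradiction with thick fullness\<close>

theorem theorem5p24:
  fixes G :: "('g, 'm) monoid_scheme"
    and X :: "'a::metric_space set"
    and T :: "'g \<Rightarrow> 'a \<Rightarrow> 'a"
    and N :: nat
  assumes "group G" and "countable (carrier G)"
    and "topological_dynamical_system G X T"
    and "N \<ge> 1"
    and "\<forall>\<epsilon>>0. \<exists>x y. \<exists>\<Omega> :: nat \<Rightarrow> 'g set.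
           (\<forall>i \<in> {1..N}. x i \<in> X \<and> y i \<in> X \<and> x i \<noteq> y i \<and>
              (\<forall>g \<in> \<Omega> i. dist (T g (x i)) (T g (y i)) \<le> \<epsilon>)) \<and>
           thickly_full G N \<Omega>"
  shows "\<not> n_fold_sTMSJ (2 * N) G X T"
proof
  assume J: "n_fold_sTMSJ (2 * N) G X T"
  interpret minimal_system G X T
    using sTMSJ_minimal_system[OF assms(3) J] assms(4) by simp
  obtain r where r: "r > 0" "\<And>x y. \<lbrakk>x \<in> X; y \<in> X; center_orbit G T x \<noteq> center_orbit G T y\<rbrakk>
      \<Longrightarrow> \<exists>g \<in> carrier G. dist (T g x) (T g y) > (r::real)"
    using sTMSJ_separated[OF assms(3) J] assms(4) by auto
  obtain e1 where e1: "e1 > 0"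
    "\<And>z. \<lbrakk>z \<in> Z; \<And>p. p \<in> X \<Longrightarrow> dist (T z p) p \<le> e1\<rbrakk> \<Longrightarrow> \<forall>p \<in> X. T z p = p"
    using center_uniformly_discrete[OF assms(2) r] by blast
  obtain S where S: "S \<subseteq> X" "infinite S"
    "\<And>p q. \<lbrakk>p \<in> S; q \<in> S; p \<noteq> q\<rbrakk> \<Longrightarrow> \<exists>e>0. \<forall>z \<in> Z. dist (T z p) (T z q) \<ge> (e::real)"
    using infinite_center_separated by blast
  \<comment> \<open>One point more than there are closeness conditions.\<close>
  obtain P where P: "finite P" "card P = N + 1" "P \<subseteq> S"
    using infinite_arbitrarily_large[OF S(2)] by blast
  obtain e2 where e2: "e2 > 0"
    "\<And>p q z. \<lbrakk>p \<in> P; q \<in> P; p \<noteq> q; z \<in> Z\<rbrakk> \<Longrightarrow> dist (T z p) (T z q) \<ge> (e2::real)"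
  proof -
    define Q where "Q = {(p, q). p \<in> P \<and> q \<in> P \<and> p \<noteq> q}"
    have "\<forall>pq \<in> Q. \<exists>e>0. \<forall>z \<in> Z. dist (T z (fst pq)) (T z (snd pq)) \<ge> (e::real)"
      using S(3) P(3) by (auto simp: Q_def)
    then obtain f where f: "\<And>pq. pq \<in> Q \<Longrightarrow> f pq > (0::real)"
      "\<And>pq z. \<lbrakk>pq \<in> Q; z \<in> Z\<rbrakk> \<Longrightarrow> dist (T z (fst pq)) (T z (snd pq)) \<ge> f pq"
      by metis
    have "finite Q" by (rule finite_subset[of _ "P \<times> P"]) (use P(1) in \<open>auto simp: Q_def\<close>)
    then have fin: "finite (insert 1 (f ` Q))" by simp
    define e where "e = Min (insert 1 (f ` Q))"
    have "e > 0" unfolding e_def using f(1) fin by (subst Min_gr_iff) auto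
    moreover have "dist (T z p) (T z q) \<ge> e" if "p \<in> P" "q \<in> P" "p \<noteq> q" "z \<in> Z" for p q z
    proof -
      have pq: "(p, q) \<in> Q" using that by (simp add: Q_def)
      then have "e \<le> f (p, q)" unfolding e_def using fin by (intro Min_le) auto
      with f(2)[OF pq that(4)] show ?thesis by simp
    qed
    ultimately show ?thesis using that by blast
  qed
  \<comment> \<open>The bound \<open>e1\<close> forces \<open>x i\<close> and \<open>y i\<close>
    into different center orbits; \<open>2 * \<epsilon> < e2\<close> prevents two points of
    \<open>P\<close> from coming \<open>\<epsilon>\<close>-close to the same point under one central
    element.\<close>
  define \<epsilon> where "\<epsilon> = min e1 (e2 / 3)"
  have \<epsilon>: "\<epsilon> > 0" "\<epsilon> \<le> e1" "2 * \<epsilon> < e2" using e1(1) e2(1) by (auto simp: \<epsilon>_def)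
  obtain x y and \<Omega> :: "nat \<Rightarrow> 'g set" where
    xy: "\<And>i. i \<in> {1..N} \<Longrightarrow> x i \<in> X" "\<And>i. i \<in> {1..N} \<Longrightarrow> y i \<in> X"
      "\<And>i. i \<in> {1..N} \<Longrightarrow> x i \<noteq> y i"
    and close: "\<And>i g. \<lbrakk>i \<in> {1..N}; g \<in> \<Omega> i\<rbrakk> \<Longrightarrow> dist (T g (x i)) (T g (y i)) \<le> \<epsilon>"
    and full: "thickly_full G N \<Omega>"
    using assms(5) \<epsilon>(1) by metis
  let ?O = "center_orbit G T"
  have xyO: "?O (x i) \<noteq> ?O (y i)" if i: "i \<in> {1..N}" for i
  proof
    assume "?O (x i) = ?O (y i)"
    then obtain z where z: "z \<in> Z" "x i = T z (y i)"
      using center_orbit_eq_iff xy i by blast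
    have "dist (T z p) p \<le> e1" if "p \<in> X" for p
    proof (rule thick_near_return[where A = "\<Omega> i" and x = "y i"])
      show "thick G (\<Omega> i)" using full i by (simp add: thickly_full_def)
      show "dist (T g (T z (y i))) (T g (y i)) \<le> e1" if "g \<in> \<Omega> i" for g
        using close[OF i that] z \<epsilon>(2) by simp
    qed (use z xy i that in auto)
    then show False using e1(2)[OF z(1)] z(2) xy i by metis
  qed
  define A where "A = x ` {1..N} \<union> y ` {1..N}"
  have AX: "A \<subseteq> X" using xy by (auto simp: A_def)
  \<comment> \<open>One representative for each center orbit met by \<open>A\<close>; there are at
    most \<open>2 * N\<close>, so the joining property applies to them.\<close>
  obtain U where U: "U \<subseteq> A" "inj_on ?O U" "?O ` A = ?O ` U"
    using subset_image_inj[of "?O ` A" ?O A] by auto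
  have finA: "finite A" by (simp add: A_def)
  have "card A \<le> card (x ` {1..N}) + card (y ` {1..N})" unfolding A_def by (rule card_Un_le)
  also have "\<dots> \<le> 2 * N"
    using card_image_le[of "{1..N}" x] card_image_le[of "{1..N}" y] by simp
  finally have card_U: "card U \<le> 2 * N" using card_mono[OF finA U(1)] by simp
  have finU: "finite U" using finA U(1) finite_subset by blast
  define k where "k = card U"
  obtain u where u: "bij_betw u {1..k} U"
    using ex_bij_betw_nat_finite_1[OF finU] unfolding k_def by blast
  have uX: "u j \<in> X" if "j \<in> {1..k}" for j
    using that u U(1) AX bij_betwE by blast
  have uO: "?O (u i) \<noteq> ?O (u j)" if "i \<in> {1..k}" "j \<in> {1..k}" "i \<noteq> j" for i j
    using that u U(2) by (metis bij_betwE bij_betw_imp_inj_on inj_onD)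
  have rep: "\<exists>j \<in> {1..k}. \<exists>z \<in> Z. s = T z (u j)" if s: "s \<in> A" for s
  proof -
    obtain v where v: "v \<in> U" "?O s = ?O v" using s U(3) by blast
    then obtain j where "j \<in> {1..k}" "v = u j" using u by (metis bij_betw_imp_surj_on imageE)
    with v show ?thesis using center_orbit_eq_iff[of s "u j"] uX s AX by blast
  qed
  \<comment> \<open>As \<open>s i\<close> and \<open>t i\<close> are central, closeness of
    \<open>T g (x i)\<close> and \<open>T g (y i)\<close> becomes a condition on coordinates
    \<open>a i\<close> and \<open>b i\<close> of the joint orbit of \<open>u\<close>.\<close>
  have "\<forall>i \<in> {1..N}. \<exists>j \<in> {1..k}. \<exists>z \<in> Z. x i = T z (u j)" using rep by (simp add: A_def)
  then obtain a s where a: "\<And>i. i \<in> {1..N} \<Longrightarrow> a i \<in> {1..k}"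
    and s: "\<And>i. i \<in> {1..N} \<Longrightarrow> s i \<in> Z" "\<And>i. i \<in> {1..N} \<Longrightarrow> x i = T (s i) (u (a i))"
    by metis
  have "\<forall>i \<in> {1..N}. \<exists>j \<in> {1..k}. \<exists>z \<in> Z. y i = T z (u j)" using rep by (simp add: A_def)
  then obtain b t where b: "\<And>i. i \<in> {1..N} \<Longrightarrow> b i \<in> {1..k}"
    and t: "\<And>i. i \<in> {1..N} \<Longrightarrow> t i \<in> Z" "\<And>i. i \<in> {1..N} \<Longrightarrow> y i = T (t i) (u (b i))"
    by metis
  have ab: "a i \<noteq> b i" if i: "i \<in> {1..N}" for i
  proof
    assume eq: "a i = b i"
    have "?O (x i) = ?O (u (a i))"
      using center_orbit_eq_iff[OF xy(1)[OF i] uX[OF a[OF i]]] s[OF i] by blast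
    moreover have "?O (y i) = ?O (u (b i))"
      using center_orbit_eq_iff[OF xy(2)[OF i] uX[OF b[OF i]]] t[OF i] by blast
    ultimately show False using xyO[OF i] eq by simp
  qed
  have sep: "p = q" if "p \<in> P" "q \<in> P" "z \<in> Z" "dist (T z p) v \<le> \<epsilon>" "dist (T z q) v \<le> \<epsilon>" for p q z v
    using that e2(2)[of p q z] \<epsilon>(3) dist_triangle2[of "T z p" "T z q" v] by fastforce
  have "\<exists>c. range c \<subseteq> P \<and> (\<forall>i \<in> {1..N}. \<not> dist (T (s i) (c (a i))) (T (t i) (c (b i))) \<le> \<epsilon>)"
  proof (rule exists_separating_choice)
    show "p = p'" if "i \<in> {1..N}" "p \<in> P" "p' \<in> P" "dist (T (s i) p) (T (t i) q) \<le> \<epsilon>"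
      "dist (T (s i) p') (T (t i) q) \<le> \<epsilon>" for i p p' q
      using sep[OF that(2,3) s(1)[OF that(1)] that(4,5)] .
    show "q = q'" if "i \<in> {1..N}" "q \<in> P" "q' \<in> P" "dist (T (s i) p) (T (t i) q) \<le> \<epsilon>"
      "dist (T (s i) p) (T (t i) q') \<le> \<epsilon>" for i p q q'
      using sep[OF that(2,3) t(1)[OF that(1)]] that(4,5) by (simp add: dist_commute)
  qed (use P ab in auto)
  then obtain c where c: "\<And>i. c i \<in> P"
    "\<And>i. i \<in> {1..N} \<Longrightarrow> dist (T (s i) (c (a i))) (T (t i) (c (b i))) > \<epsilon>"
    by (metis not_le rangeI subsetD)
  have cX: "c i \<in> X" for i using c(1) P(3) S(1) by blast
  \<comment> \<open>The configurations that violate all closeness conditions; \<open>c\<close>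
    restricted to \<open>{1..k}\<close> is one of them.\<close>
  define V where "V = topspace (power_topology X k) \<inter> (\<Inter>i\<in>{1..N}.
    {c \<in> topspace (power_topology X k). dist (T (s i) (c (a i))) (T (t i) (c (b i))) > \<epsilon>})"
  have V: "openin (power_topology X k) V"
  proof -
    have "openin (power_topology X k)
      {c \<in> topspace (power_topology X k). dist (T (s i) (c (a i))) (T (t i) (c (b i))) > \<epsilon>}"
      if "i \<in> {1..N}" for i
      using that a b s t center_carrier continuous_action by (intro openin_power_dist) auto
    then show ?thesis unfolding V_def using assms(4)
      by (intro openin_Int openin_topspace openin_INT2) auto
  qed
  have one: "1 \<in> {1..k}" using a[of 1] assms(4) by auto
  \<comment> \<open>Only the first coordinate of \<open>c\<close> varies. Its admissible values form
    a nonempty open set, infinite since \<open>X\<close> is perfect, so some value avoids the finite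
    set \<open>F\<close>.\<close>
  define ins where "ins p = (\<lambda>i \<in> {1..k}. if i = 1 then p else c i)" for p
  have "continuous_map (top_of_set X) (power_topology X k) ins"
    unfolding power_topology_def
    by (subst continuous_map_componentwise) (auto simp: ins_def cX)
  then have "openin (top_of_set X) {p \<in> X. ins p \<in> V}"
    using openin_continuous_map_preimage[OF _ V] by fastforce
  moreover have "ins (c 1) = restrict c {1..k}" by (auto simp: ins_def)
  then have "ins (c 1) \<in> V"
    using a b c(2) cX by (simp add: V_def topspace_power)
  then have "{p \<in> X. ins p \<in> V} \<noteq> {}" using cX by blast
  ultimately have inf: "infinite {p \<in> X. ins p \<in> V}" by (rule infinite_openin)
  define E where "E = carrier G - (\<Union>i \<in> {1..N}. \<Omega> i)"
  have finE: "finite E" using full by (simp add: thickly_full_def E_def)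
  \<comment> \<open>The positions of \<open>u 1\<close> under the exceptional elements: keeping the
    first coordinate outside \<open>F\<close> keeps \<open>g\<close> outside
    \<open>E\<close>.\<close>
  define F where "F = (\<lambda>g. T g (u 1)) ` E"
  have finF: "finite F" using finE by (simp add: F_def)
  define W where "W = V \<inter> {c \<in> topspace (power_topology X k). c 1 \<in> X - F}"
  have "openin (top_of_set X) (X - F)"
    using finF by (metis Diff_eq finite_imp_closed open_Compl openin_open_Int)
  then have W: "openin (power_topology X k) W"
    unfolding W_def
    by (intro openin_Int V openin_continuous_map_preimage[OF continuous_map_power_projection[OF one]])
  have "\<not> {p \<in> X. ins p \<in> V} \<subseteq> F" using inf finite_subset[OF _ finF] by auto
  then obtain p where "p \<in> X" "ins p \<in> V" "p \<notin> F" by blast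
  then have "ins p \<in> W"
    using one by (auto simp: W_def V_def ins_def)
  then have ne: "W \<noteq> {}" by blast
  have "k \<in> {1..2 * N}" using one card_U by (simp add: k_def)
  then have "\<exists>g \<in> carrier G. (\<lambda>i \<in> {1..k}. T g (u i)) \<in> W"
    by (rule sTMSJ_dense[OF J _ _ _ W ne]) (fact uX, fact uO)
  then obtain g where g: "g \<in> carrier G" "(\<lambda>i \<in> {1..k}. T g (u i)) \<in> W" ..
  have "g \<notin> \<Omega> i" if i: "i \<in> {1..N}" for i
  proof
    assume "g \<in> \<Omega> i"
    then have "dist (T g (x i)) (T g (y i)) \<le> \<epsilon>" using close i by blast
    moreover have "T g (x i) = T (s i) (T g (u (a i)))" "T g (y i) = T (t i) (T g (u (b i)))"
      using center_commute uX a b s t g(1) i by simp_all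
    moreover have "dist (T (s i) (T g (u (a i)))) (T (t i) (T g (u (b i)))) > \<epsilon>"
      using g(2) a b i by (auto simp: W_def V_def)
    ultimately show False by simp
  qed
  then have "g \<in> E" using g(1) by (simp add: E_def)
  moreover have "T g (u 1) \<notin> F" using g(2) one by (auto simp: W_def)
  ultimately show False by (simp add: F_def)
qed

end
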